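(* For every integer $t\ge 4$, the tree $T(t,t,t,t)$ has $n=8t+4$ vertices (so $n$ is divisible by $4$) and satisfies \[ \pi(T(t,t,t,t)) > \frac{4n^2+8n+24}{n(n+4)}\left(\frac32\right)^{(n-6)/2}. \]
   Context: All graphs are finite and simple. For a graph $G$, $d(v)$ denotes the degree of a vertex $v$, and $L(G)=D(G)-A(G)$ is the Laplacian matrix, where $A(G)$ is the adjacency matrix and $D(G)$ is the diagonal matrix of degrees. The permanent of an $n\times n$ matrix $M=(m_{ij})$ is $\operatorname{per}(M)=\sum_{\sigma\in S_n}\prod_{i=1}^n m_{i,\sigma(i)}$. If $G$ has no isolated vertices, its Laplacian ratio is $\pi(G)=\operatorname{per}(L(G))/\prod_{v\in V(G)}d(v)$. For $m\ge 2$ and nonnegative integers $a_1,\ldots,a_m$, the tree $T(a_1,\ldots,a_m)$ is obtained from the path $x_1-x_2-\cdots-x_m$ by attaching, for each $i$, exactly $a_i$ pendant paths of length two to the vertex $x_i$; that is, each attached path has the form $x_i-y-z$ with new vertices $y,z$, where $y$ is adjacent exactly to $x_i$ and $z$, and $z$ is a leaf. *)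

theory Defs
  imports
    Complex_Main
    "HOL-Combinatorics.Permutations"
    "Graph_Theory.Pair_Digraph"
begin

(* A finite simple graph is a symmetric loop-free finite digraph without parallel arcs
   (locale pair_graph): an edge uv is the pair of arcs (u,v), (v,u), so the degree of a
   vertex is its out-degree. *)

abbreviation degree :: "'a pair_pre_digraph \<Rightarrow> 'a \<Rightarrow> nat" where
  "degree G v \<equiv> out_degree (with_proj G) v"

(* Square matrices are indexed by a finite set of vertices instead of by {1..n}; the
   permanent does not depend on how the vertices are numbered. *)

definition permanent :: "'a set \<Rightarrow> ('a \<Rightarrow> 'a \<Rightarrow> 'b::comm_semiring_1) \<Rightarrow> 'b" where
  "permanent V M = (\<Sum>\<sigma> | \<sigma> permutes V. \<Prod>v\<in>V. M v (\<sigma> v))"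

definition adjacency_matrix :: "'a pair_pre_digraph \<Rightarrow> 'a \<Rightarrow> 'a \<Rightarrow> real" where
  "adjacency_matrix G u v = (if (u, v) \<in> parcs G then 1 else 0)"

definition degree_matrix :: "'a pair_pre_digraph \<Rightarrow> 'a \<Rightarrow> 'a \<Rightarrow> real" where
  "degree_matrix G u v = (if u = v then real (degree G u) else 0)"

definition laplacian :: "'a pair_pre_digraph \<Rightarrow> 'a \<Rightarrow> 'a \<Rightarrow> real" where
  "laplacian G u v = degree_matrix G u v - adjacency_matrix G u v"

(* Meaningful only for graphs without isolated vertices. *)
definition laplacian_ratio :: "'a pair_pre_digraph \<Rightarrow> real" where
  "laplacian_ratio G =
     permanent (pverts G) (laplacian G) / (\<Prod>v\<in>pverts G. real (degree G v))"

(* Indices start at 0: Spine i is x_(i+1), and the j-th pendant path attached to it is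
   Spine i - Mid i j - Leaf i j. *)
datatype tree_vertex = Spine nat | Mid nat nat | Leaf nat nat

definition pendant_tree_edges :: "nat list \<Rightarrow> tree_vertex rel" where
  "pendant_tree_edges as =
     {(Spine i, Spine (Suc i)) | i. Suc i < length as}
     \<union> {(Spine i, Mid i j) | i j. i < length as \<and> j < as ! i}
     \<union> {(Mid i j, Leaf i j) | i j. i < length as \<and> j < as ! i}"

(* T(a_1,...,a_m) for as = [a_1,...,a_m]; intended for length as >= 2. *)
definition pendant_tree :: "nat list \<Rightarrow> tree_vertex pair_pre_digraph" where
  "pendant_tree as =
     \<lparr> pverts = {Spine i | i. i < length as}
         \<union> {Mid i j | i j. i < length as \<and> j < as ! i}
         \<union> {Leaf i j | i j. i < length as \<and> j < as ! i},
       parcs = pendant_tree_edges as \<union> (pendant_tree_edges as)\<inverse> \<rparr>"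

lemma finite_pverts_pendant_tree: "finite (pverts (pendant_tree as))"
proof -
  have "pverts (pendant_tree as) =
    Spine ` {..<length as}
    \<union> (\<Union>i<length as. Mid i ` {..<as ! i})
    \<union> (\<Union>i<length as. Leaf i ` {..<as ! i})"
    by (auto simp: pendant_tree_def)
  then show ?thesis by simp
qed

lemma pair_graph_pendant_tree: "pair_graph (pendant_tree as)"
proof -
  have wf: "fst e \<in> pverts (pendant_tree as) \<and> snd e \<in> pverts (pendant_tree as)
      \<and> fst e \<noteq> snd e"
    if "e \<in> parcs (pendant_tree as)" for e
    using that by (auto simp: pendant_tree_def pendant_tree_edges_def)
  have "parcs (pendant_tree as) \<subseteq> pverts (pendant_tree as) \<times> pverts (pendant_tree as)"
    using wf by (auto simp: mem_Times_iff)
  then have fin: "finite (parcs (pendant_tree as))"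
    by (rule finite_subset) (simp add: finite_pverts_pendant_tree)
  have "sym (parcs (pendant_tree as))"
    by (auto simp: pendant_tree_def sym_def)
  then have "symmetric (with_proj (pendant_tree as))"
    by (simp add: symmetric_def)
  then show ?thesis
    using wf fin finite_pverts_pendant_tree by unfold_locales auto
qed

lemma degree_pendant_tree_pos:
  assumes "length as \<ge> 2" and "v \<in> pverts (pendant_tree as)"
  shows "degree (pendant_tree as) v > 0"
proof -
  interpret pair_graph "pendant_tree as" by (rule pair_graph_pendant_tree)
  have "\<exists>w. (v, w) \<in> parcs (pendant_tree as)"
  proof (cases v)
    case (Spine i)
    then have i: "i < length as" using assms(2) by (auto simp: pendant_tree_def)
    show ?thesis
    proof (cases i)
      case 0
      then have "(v, Spine 1) \<in> parcs (pendant_tree as)"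
        using Spine assms(1) by (auto simp: pendant_tree_def pendant_tree_edges_def)
      then show ?thesis by blast
    next
      case (Suc k)
      then have "(v, Spine k) \<in> parcs (pendant_tree as)"
        using Spine i by (auto simp: pendant_tree_def pendant_tree_edges_def)
      then show ?thesis by blast
    qed
  next
    case (Mid i j)
    then have "(v, Spine i) \<in> parcs (pendant_tree as)"
      using assms(2) by (auto simp: pendant_tree_def pendant_tree_edges_def)
    then show ?thesis by blast
  next
    case (Leaf i j)
    then have "(v, Mid i j) \<in> parcs (pendant_tree as)"
      using assms(2) by (auto simp: pendant_tree_def pendant_tree_edges_def)
    then show ?thesis by blast
  qed
  then have "out_arcs (with_proj (pendant_tree as)) v \<noteq> {}"
    by (auto simp: out_arcs_def)
  moreover have "finite (out_arcs (with_proj (pendant_tree as)) v)"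
    using pair_finite_arcs by (auto simp: out_arcs_def)
  ultimately show ?thesis by (simp add: out_degree_def card_gt_0_iff)
qed

end

theory Submission
  imports Defs
begin

text \<open>
  In the Laplacian of a tree every permutation that is not a product of disjoint transpositions
  along edges contributes \<open>0\<close> to the permanent, so the permanent can be computed by stripping off
  leaves (\<open>permanent_leaf\<close>), just as one counts weighted matchings.

  Strip a pendant path \<open>x - y - z\<close> in this way. Deleting \<open>z\<close>, then \<open>y\<close>, gives
  \<open>3 per (W) + per (W - x)\<close>, where \<open>W\<close> is the vertex set of the rest. The permanent is affine in
  the diagonal entry at \<open>x\<close>, with slope \<open>per (W - x)\<close>; hence this value is exactly three times the
  permanent on \<open>W\<close> after adding \<open>1/3\<close> to that entry (\<open>permanent_pendant_path\<close>). The paths can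
  therefore be removed one after the other without ever branching, and \<open>T(a\<^sub>1, \<dots>, a\<^sub>m)\<close>
  collapses to its spine: a factor \<open>3\<close> for every path, and \<open>a\<^sub>i / 3\<close> added to the \<open>i\<close>-th diagonal
  entry (\<open>permanent_laplacian_pendant_tree\<close>).

  For \<open>T(t, t, t, t)\<close> a tridiagonal permanent of order four remains. With \<open>A = (4 t + 3) / 3\<close> and
  \<open>B = (4 t + 6) / 3\<close>, division by the degrees gives
  \<open>\<pi> = (3/2)^(4 t) (A\<^sup>2 B\<^sup>2 + 2 A B + A\<^sup>2 + 1) / ((t + 1)\<^sup>2 (t + 2)\<^sup>2)\<close>.
  The factor beside the power of \<open>3/2\<close> tends to \<open>(4/3)^4 = 256/81\<close>, and the corresponding factor of
  the bound to \<open>8/3 < 256/81\<close>. The convergence is slow: at \<open>t = 4\<close> the two factors agree to within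
  a tenth of a percent. The polynomial inequality between them is therefore proved by expanding
  around \<open>t = 4\<close>, where all coefficients of the difference are positive
  (\<open>spine_factor_bound\<close>).
\<close>

section \<open>Expansion of permanents\<close>

lemma permutes_insert_fixing:
  assumes "z \<notin> W"
  shows "{\<sigma>. \<sigma> permutes insert z W \<and> \<sigma> z = z} = {\<sigma>. \<sigma> permutes W}"
proof -
  have "\<sigma> permutes W" if "\<sigma> permutes insert z W" "\<sigma> z = z" for \<sigma>
    by (rule permutes_superset[OF that(1)]) (use that in auto)
  moreover have "\<sigma> permutes insert z W \<and> \<sigma> z = z" if "\<sigma> permutes W" for \<sigma>
    using permutes_subset[OF that] permutes_not_in[OF that assms] by blast
  ultimately show ?thesis by blast
qed

lemma permanent_split_fixed:
  assumes "finite W" and "z \<notin> W"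
  shows "permanent (insert z W) M = M z z * permanent W M
    + (\<Sum>\<sigma> | \<sigma> permutes insert z W \<and> \<sigma> z \<noteq> z. \<Prod>v\<in>insert z W. M v (\<sigma> v))"
proof -
  let ?f = "\<lambda>\<sigma>. \<Prod>v\<in>insert z W. M v (\<sigma> v)"
  let ?A = "{\<sigma>. \<sigma> permutes insert z W \<and> \<sigma> z = z}"
  let ?B = "{\<sigma>. \<sigma> permutes insert z W \<and> \<sigma> z \<noteq> z}"
  have fin: "finite {\<sigma>. \<sigma> permutes insert z W}"
    by (rule finite_permutations) (use assms in simp)
  have "sum ?f {\<sigma>. \<sigma> permutes insert z W} = sum ?f (?A \<union> ?B)"
    by (rule arg_cong[where f = "sum ?f"]) blast
  also have "\<dots> = sum ?f ?A + sum ?f ?B"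
    by (rule sum.union_disjoint) (auto intro: finite_subset[OF _ fin])
  also have "sum ?f ?A = (\<Sum>\<sigma> | \<sigma> permutes W. M z z * (\<Prod>v\<in>W. M v (\<sigma> v)))"
    unfolding permutes_insert_fixing[OF assms(2)]
    by (rule sum.cong) (use assms in \<open>auto simp: permutes_not_in\<close>)
  finally show ?thesis
    by (simp add: permanent_def sum_distrib_left)
qed

lemma permanent_isolated:
  assumes "finite W" and "z \<notin> W" and "\<And>v. v \<in> W \<Longrightarrow> M z v = 0"
  shows "permanent (insert z W) M = M z z * permanent W M"
proof -
  have "(\<Prod>v\<in>insert z W. M v (\<sigma> v)) = 0"
    if "\<sigma> permutes insert z W" "\<sigma> z \<noteq> z" for \<sigma>
  proof -
    have "\<sigma> z \<in> W" using permutes_in_image[OF that(1), of z] that(2) by simp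
    then show ?thesis using assms by simp
  qed
  then have "(\<Sum>\<sigma> | \<sigma> permutes insert z W \<and> \<sigma> z \<noteq> z. \<Prod>v\<in>insert z W. M v (\<sigma> v)) = 0"
    by (intro sum.neutral) auto
  then show ?thesis using permanent_split_fixed[OF assms(1,2), of M] by simp
qed

lemma permutes_swapping:
  assumes "z \<notin> W" and "y \<in> W"
  shows "bij_betw (\<lambda>\<tau>. transpose z y \<circ> \<tau>) {\<tau>. \<tau> permutes W - {y}}
    {\<sigma>. \<sigma> permutes insert z W \<and> \<sigma> z = y \<and> \<sigma> y = z}"
proof (rule bij_betw_byWitness[where f' = "\<lambda>\<sigma>. transpose z y \<circ> \<sigma>"])
  let ?T = "{\<tau>. \<tau> permutes W - {y}}"
  let ?S = "{\<sigma>. \<sigma> permutes insert z W \<and> \<sigma> z = y \<and> \<sigma> y = z}"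
  have tr: "transpose z y permutes insert z W"
    by (rule permutes_swap_id) (use assms in auto)
  show "(\<lambda>\<tau>. transpose z y \<circ> \<tau>) ` ?T \<subseteq> ?S"
  proof (rule image_subsetI, clarsimp, intro conjI)
    fix \<tau> assume \<tau>: "\<tau> permutes W - {y}"
    have "\<tau> permutes insert z W" by (rule permutes_subset[OF \<tau>]) auto
    then show "transpose z y \<circ> \<tau> permutes insert z W" by (rule permutes_compose) (rule tr)
    have "\<tau> z = z" "\<tau> y = y" using permutes_not_in[OF \<tau>] assms by auto
    then show "transpose z y (\<tau> z) = y" "transpose z y (\<tau> y) = z" by auto
  qed
  show "(\<lambda>\<sigma>. transpose z y \<circ> \<sigma>) ` ?S \<subseteq> ?T"
  proof (rule image_subsetI, rule CollectI)
    fix \<sigma> assume "\<sigma> \<in> ?S"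
    then have \<sigma>: "\<sigma> permutes insert z W" "\<sigma> z = y" "\<sigma> y = z" by auto
    have "transpose z y \<circ> \<sigma> permutes insert z W" using \<sigma>(1) tr by (rule permutes_compose)
    then show "transpose z y \<circ> \<sigma> permutes W - {y}"
      by (rule permutes_superset) (use \<sigma> in auto)
  qed
qed (auto simp: fun_eq_iff)

text \<open>If \<open>z\<close> is a leaf hanging from \<open>y\<close>, a permutation with a nonzero product either fixes
  \<open>z\<close> or moves \<open>z\<close> to \<open>y\<close>; since only row \<open>y\<close> can return to column \<open>z\<close>, in the second case it
  swaps \<open>z\<close> and \<open>y\<close>.\<close>

lemma permanent_leaf:
  assumes "finite W" and "z \<notin> W" and "y \<in> W"
    and row: "\<And>v. v \<in> W \<Longrightarrow> v \<noteq> y \<Longrightarrow> M z v = 0"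
    and col: "\<And>v. v \<in> W \<Longrightarrow> v \<noteq> y \<Longrightarrow> M v z = 0"
  shows "permanent (insert z W) M
    = M z z * permanent W M + M z y * M y z * permanent (W - {y}) M"
proof -
  let ?f = "\<lambda>\<sigma>. \<Prod>v\<in>insert z W. M v (\<sigma> v)"
  let ?B = "{\<sigma>. \<sigma> permutes insert z W \<and> \<sigma> z \<noteq> z}"
  let ?S = "{\<sigma>. \<sigma> permutes insert z W \<and> \<sigma> z = y \<and> \<sigma> y = z}"
  have zy: "z \<noteq> y" using assms by auto
  have fin: "finite {\<sigma>. \<sigma> permutes insert z W}"
    by (rule finite_permutations) (use assms in simp)
  have "?f \<sigma> = 0" if "\<sigma> \<in> ?B - ?S" for \<sigma>
  proof -
    from that have \<sigma>: "\<sigma> permutes insert z W" "\<sigma> z \<noteq> z" "\<not> (\<sigma> z = y \<and> \<sigma> y = z)"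
      by auto
    have "\<exists>v\<in>insert z W. M v (\<sigma> v) = 0"
    proof (cases "\<sigma> z = y")
      case False
      have "\<sigma> z \<in> W" using permutes_in_image[OF \<sigma>(1), of z] \<sigma>(2) by simp
      then show ?thesis using row False by blast
    next
      case True
      obtain u where u: "\<sigma> u = z" using permutes_surj[OF \<sigma>(1)] by (metis surjD)
      then have "u \<in> insert z W" using permutes_in_image[OF \<sigma>(1), of u] by simp
      moreover have "u \<noteq> z" "u \<noteq> y" using u \<sigma>(2,3) True by auto
      ultimately show ?thesis using col[of u] u by auto
    qed
    then show ?thesis using assms(1) by (intro prod_zero) auto
  qed
  then have "sum ?f ?B = sum ?f ?S"
    using zy by (intro sum.mono_neutral_right) (auto intro: finite_subset[OF _ fin])
  also have "\<dots> = (\<Sum>\<tau> | \<tau> permutes W - {y}. ?f (transpose z y \<circ> \<tau>))"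
    by (rule sum.reindex_bij_betw[OF permutes_swapping[OF assms(2,3)], symmetric])
  also have "\<dots> = (\<Sum>\<tau> | \<tau> permutes W - {y}. M z y * M y z * (\<Prod>v\<in>W - {y}. M v (\<tau> v)))"
  proof (rule sum.cong, simp, clarify)
    fix \<tau> assume \<tau>: "\<tau> permutes W - {y}"
    have *: "\<tau> z = z" "\<tau> y = y" using permutes_not_in[OF \<tau>] assms by auto
    have "?f (transpose z y \<circ> \<tau>)
        = M z y * M y z * (\<Prod>v\<in>W - {y}. M v ((transpose z y \<circ> \<tau>) v))"
      using assms(1-3) zy * by (simp add: prod.remove[of W y] mult.assoc)
    also have "(\<Prod>v\<in>W - {y}. M v ((transpose z y \<circ> \<tau>) v)) = (\<Prod>v\<in>W - {y}. M v (\<tau> v))"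
    proof (rule prod.cong[OF refl])
      fix v assume "v \<in> W - {y}"
      then have "\<tau> v \<in> W - {y}" using permutes_in_image[OF \<tau>] by blast
      then have "\<tau> v \<noteq> z" "\<tau> v \<noteq> y" using assms(2) by auto
      then show "M v ((transpose z y \<circ> \<tau>) v) = M v (\<tau> v)" by simp
    qed
    finally show "?f (transpose z y \<circ> \<tau>) = M z y * M y z * (\<Prod>v\<in>W - {y}. M v (\<tau> v))" .
  qed
  also have "\<dots> = M z y * M y z * permanent (W - {y}) M"
    by (simp add: permanent_def sum_distrib_left)
  finally show ?thesis using permanent_split_fixed[OF assms(1,2), of M] by simp
qed

lemma permanent_cong:
  assumes "\<And>u v. u \<in> W \<Longrightarrow> v \<in> W \<Longrightarrow> M u v = N u v"
  shows "permanent W M = permanent W N"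
  unfolding permanent_def
proof (rule sum.cong[OF refl], rule prod.cong[OF refl])
  fix \<sigma> v assume "\<sigma> \<in> {\<sigma>. \<sigma> permutes W}" "v \<in> W"
  then show "M v (\<sigma> v) = N v (\<sigma> v)" using assms permutes_in_image[of \<sigma> W v] by simp
qed

section \<open>Pendant paths of length two\<close>

definition add_diagonal :: "('a \<Rightarrow> 'b) \<Rightarrow> ('a \<Rightarrow> 'a \<Rightarrow> 'b) \<Rightarrow> 'a \<Rightarrow> 'a \<Rightarrow> 'b::comm_semiring_1"
  where "add_diagonal c M u v = M u v + (if u = v then c u else 0)"

lemma permanent_add_diagonal_single:
  assumes "finite W" and "x \<in> W"
  shows "permanent W (add_diagonal (\<lambda>u. if u = x then a else 0) M)
    = permanent W M + a * permanent (W - {x}) M"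
proof -
  let ?N = "add_diagonal (\<lambda>u. if u = x then a else 0) M"
  let ?W = "W - {x}"
  have W: "W = insert x ?W" using assms by auto
  have off: "(\<Sum>\<sigma> | \<sigma> permutes insert x ?W \<and> \<sigma> x \<noteq> x. \<Prod>v\<in>insert x ?W. ?N v (\<sigma> v))
      = (\<Sum>\<sigma> | \<sigma> permutes insert x ?W \<and> \<sigma> x \<noteq> x. \<Prod>v\<in>insert x ?W. M v (\<sigma> v))"
    by (intro sum.cong prod.cong) (auto simp: add_diagonal_def)
  have less: "permanent ?W ?N = permanent ?W M"
    by (rule permanent_cong) (auto simp: add_diagonal_def)
  have fin: "finite ?W" "x \<notin> ?W" using assms by auto
  have "permanent (insert x ?W) ?N = permanent (insert x ?W) M + a * permanent ?W M"
    unfolding permanent_split_fixed[OF fin] off less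
    by (simp add: add_diagonal_def algebra_simps)
  then show ?thesis using W by simp
qed

text \<open>Expanding at \<open>z\<close>, then at \<open>y\<close>, produces the two permanents \<open>permanent W M\<close> and
  \<open>permanent (W - {x}) M\<close>. Absorbing the second one into the diagonal keeps the result a single
  permanent, so that the reduction can be iterated over many paths at the same \<open>x\<close>.\<close>

lemma permanent_pendant_path:
  fixes M :: "'a \<Rightarrow> 'a \<Rightarrow> real"
  assumes "finite W" and "x \<in> W" and "y \<notin> W" and "z \<notin> W" and "y \<noteq> z"
    and "M z z = 1" and "M y y = 2"
    and "M z y = -1" and "M y z = -1" and "M x y = -1" and "M y x = -1"
    and "\<And>v. v \<in> W \<Longrightarrow> M z v = 0" and "\<And>v. v \<in> W \<Longrightarrow> M v z = 0"
    and "\<And>v. v \<in> W \<Longrightarrow> v \<noteq> x \<Longrightarrow> M y v = 0" and "\<And>v. v \<in> W \<Longrightarrow> v \<noteq> x \<Longrightarrow> M v y = 0"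
  shows "permanent (insert z (insert y W)) M
    = 3 * permanent W (add_diagonal (\<lambda>u. if u = x then 1 / 3 else 0) M)"
proof -
  have "permanent (insert z (insert y W)) M = permanent (insert y W) M + permanent W M"
    using assms by (subst permanent_leaf[where y = y]) auto
  also have "permanent (insert y W) M = 2 * permanent W M + permanent (W - {x}) M"
    using assms by (subst permanent_leaf[where y = x]) auto
  finally show ?thesis
    by (simp add: permanent_add_diagonal_single[OF assms(1,2)])
qed

section \<open>The Laplacian of a tree with pendant paths\<close>

lemma degree_eq_card_neighbours: "degree G v = card {w. (v, w) \<in> parcs G}"
proof -
  have "out_arcs (with_proj G) v = Pair v ` {w. (v, w) \<in> parcs G}"
    by (auto simp: out_arcs_def)
  then show ?thesis
    by (simp add: out_degree_def card_image inj_on_def)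
qed

definition pendant_indices :: "nat list \<Rightarrow> (nat \<times> nat) set" where
  "pendant_indices as = (SIGMA i:{..<length as}. {..<as ! i})"

lemma finite_pendant_indices: "finite (pendant_indices as)"
  by (simp add: pendant_indices_def)

lemma card_pendant_indices: "card (pendant_indices as) = sum_list as"
  by (simp add: pendant_indices_def sum_list_sum_nth atLeast0LessThan)

lemma pverts_pendant_tree:
  "pverts (pendant_tree as) = Spine ` {..<length as}
     \<union> case_prod Mid ` pendant_indices as \<union> case_prod Leaf ` pendant_indices as"
  by (auto simp: pendant_tree_def pendant_indices_def)

lemma parcs_pendant_tree:
  "parcs (pendant_tree as) = pendant_tree_edges as \<union> (pendant_tree_edges as)\<inverse>"
  by (simp add: pendant_tree_def)

lemma card_Mid_image: "card (case_prod Mid ` P) = card P"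
  by (rule card_image) (auto simp: inj_on_def)

lemma card_Leaf_image: "card (case_prod Leaf ` P) = card P"
  by (rule card_image) (auto simp: inj_on_def)

lemma card_pverts_pendant_tree:
  "card (pverts (pendant_tree as)) = length as + 2 * sum_list as"
proof -
  have "card (Spine ` {..<length as}) = length as"
    by (simp add: card_image inj_on_def)
  then show ?thesis
    unfolding pverts_pendant_tree
    by (subst card_Un_disjoint; (subst card_Un_disjoint)?)
      (auto simp: finite_pendant_indices card_Mid_image card_Leaf_image card_pendant_indices)
qed

lemma degree_Leaf:
  assumes "(i, j) \<in> pendant_indices as"
  shows "degree (pendant_tree as) (Leaf i j) = 1"
proof -
  have "{w. (Leaf i j, w) \<in> parcs (pendant_tree as)} = {Mid i j}"
    using assms by (auto simp: parcs_pendant_tree pendant_tree_edges_def pendant_indices_def)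
  then show ?thesis by (simp add: degree_eq_card_neighbours)
qed

lemma degree_Mid:
  assumes "(i, j) \<in> pendant_indices as"
  shows "degree (pendant_tree as) (Mid i j) = 2"
proof -
  have "{w. (Mid i j, w) \<in> parcs (pendant_tree as)} = {Spine i, Leaf i j}"
    using assms by (auto simp: parcs_pendant_tree pendant_tree_edges_def pendant_indices_def)
  then show ?thesis by (simp add: degree_eq_card_neighbours)
qed

lemma degree_Spine:
  assumes "i < length as"
  shows "degree (pendant_tree as) (Spine i)
    = as ! i + card {k. k < length as \<and> (k = Suc i \<or> i = Suc k)}"
proof -
  let ?K = "{k. k < length as \<and> (k = Suc i \<or> i = Suc k)}"
  have "{w. (Spine i, w) \<in> parcs (pendant_tree as)} = Mid i ` {..<as ! i} \<union> Spine ` ?K"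
    using assms by (auto simp: parcs_pendant_tree pendant_tree_edges_def)
  moreover have "card (Mid i ` {..<as ! i} \<union> Spine ` ?K) = as ! i + card ?K"
    by (subst card_Un_disjoint) (auto simp: card_image inj_on_def)
  ultimately show ?thesis by (simp add: degree_eq_card_neighbours)
qed

lemma prod_degree_pendant_tree:
  "(\<Prod>v\<in>pverts (pendant_tree as). real (degree (pendant_tree as) v))
     = 2 ^ sum_list as * (\<Prod>i<length as. real (degree (pendant_tree as) (Spine i)))"
proof -
  let ?d = "\<lambda>v. real (degree (pendant_tree as) v)"
  have "prod ?d (case_prod Mid ` pendant_indices as) = (\<Prod>v\<in>case_prod Mid ` pendant_indices as. 2)"
    by (rule prod.cong) (auto simp: degree_Mid)
  moreover have "prod ?d (case_prod Leaf ` pendant_indices as) = 1"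
    by (rule prod.neutral) (auto simp: degree_Leaf)
  moreover have "prod ?d (Spine ` {..<length as}) = (\<Prod>i<length as. ?d (Spine i))"
    by (subst prod.reindex) (auto simp: inj_on_def)
  ultimately show ?thesis
    unfolding pverts_pendant_tree
    by (subst prod.union_disjoint; (subst prod.union_disjoint)?)
      (auto simp: finite_pendant_indices card_Mid_image card_pendant_indices)
qed

text \<open>Each removed path changes the diagonal of what is left, so the induction has to run over
  all diagonal perturbations \<open>c\<close>; they live on the spine, because only spine vertices carry
  paths.\<close>

lemma permanent_laplacian_peel:
  fixes as :: "nat list" and c :: "tree_vertex \<Rightarrow> real"
  defines "L \<equiv> laplacian (pendant_tree as)" and "S \<equiv> Spine ` {..<length as}"
  assumes "finite P" and "P \<subseteq> pendant_indices as"
    and "\<And>i j. c (Mid i j) = 0" and "\<And>i j. c (Leaf i j) = 0"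
  shows "permanent (S \<union> case_prod Mid ` P \<union> case_prod Leaf ` P) (add_diagonal c L)
    = 3 ^ card P * permanent S
        (add_diagonal (\<lambda>u. c u + real (card {p \<in> P. Spine (fst p) = u}) / 3) L)"
  using assms(3-)
proof (induction P arbitrary: c rule: finite_induct)
  case empty
  then show ?case by simp
next
  case (insert p P)
  obtain i j where p: "p = (i, j)" by fastforce
  have ij: "(i, j) \<in> pendant_indices as" using insert.prems(1) p by auto
  let ?W = "S \<union> case_prod Mid ` P \<union> case_prod Leaf ` P"
  let ?e = "\<lambda>u. if u = Spine i then 1 / 3 else (0::real)"
  have new: "Mid i j \<notin> ?W" "Leaf i j \<notin> ?W"
    using insert.hyps(2) p by (auto simp: S_def)
  have "permanent (insert (Leaf i j) (insert (Mid i j) ?W)) (add_diagonal c L)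
      = 3 * permanent ?W (add_diagonal ?e (add_diagonal c L))"
  proof (rule permanent_pendant_path)
    show "finite ?W" using insert.hyps(1) by (simp add: S_def)
    show "Spine i \<in> ?W" using ij by (simp add: S_def pendant_indices_def)
  qed (use ij new insert.prems(2,3) in \<open>auto simp: L_def add_diagonal_def laplacian_def
      degree_matrix_def adjacency_matrix_def degree_Mid degree_Leaf parcs_pendant_tree
      pendant_tree_edges_def pendant_indices_def S_def simp del: One_nat_def\<close>)
  also have "add_diagonal ?e (add_diagonal c L) = add_diagonal (\<lambda>u. c u + ?e u) L"
    by (auto simp: add_diagonal_def fun_eq_iff)
  also have "permanent ?W (add_diagonal (\<lambda>u. c u + ?e u) L) = 3 ^ card P * permanent S
      (add_diagonal (\<lambda>u. c u + ?e u + real (card {p \<in> P. Spine (fst p) = u}) / 3) L)"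
    by (rule insert.IH) (use insert.prems in auto)
  also have "(\<lambda>u. c u + ?e u + real (card {p \<in> P. Spine (fst p) = u}) / 3)
      = (\<lambda>u. c u + real (card {q \<in> insert p P. Spine (fst q) = u}) / 3)"
  proof
    fix u
    have "{q \<in> insert p P. Spine (fst q) = u}
        = (if u = Spine i then insert p else id) {q \<in> P. Spine (fst q) = u}"
      using p by auto
    then have "card {q \<in> insert p P. Spine (fst q) = u}
        = card {q \<in> P. Spine (fst q) = u} + (if u = Spine i then 1 else 0)"
      using insert.hyps by simp
    then show "c u + ?e u + real (card {p \<in> P. Spine (fst p) = u}) / 3
        = c u + real (card {q \<in> insert p P. Spine (fst q) = u}) / 3"
      by (simp add: add_divide_distrib)
  qed
  finally show ?case
    using insert.hyps p by (simp add: insert_commute Un_assoc)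
qed

text \<open>The degrees in this matrix are those of the whole tree, not those of the spine alone.\<close>

definition spine_matrix :: "nat list \<Rightarrow> tree_vertex \<Rightarrow> tree_vertex \<Rightarrow> real" where
  "spine_matrix as = add_diagonal
     (\<lambda>u. case u of Spine i \<Rightarrow> real (as ! i) / 3 | _ \<Rightarrow> 0) (laplacian (pendant_tree as))"

lemma permanent_laplacian_pendant_tree:
  "permanent (pverts (pendant_tree as)) (laplacian (pendant_tree as))
     = 3 ^ sum_list as * permanent (Spine ` {..<length as}) (spine_matrix as)"
proof -
  have card: "card {p \<in> pendant_indices as. fst p = i} = as ! i"
    if "i < length as" for i
  proof -
    have "{p \<in> pendant_indices as. fst p = i} = Pair i ` {..<as ! i}"
      using that by (auto simp: pendant_indices_def)
    then show ?thesis by (simp add: card_image inj_on_def)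
  qed
  have "laplacian (pendant_tree as) = add_diagonal (\<lambda>u. 0) (laplacian (pendant_tree as))"
    by (simp add: add_diagonal_def fun_eq_iff)
  then have "permanent (pverts (pendant_tree as)) (laplacian (pendant_tree as))
      = 3 ^ sum_list as * permanent (Spine ` {..<length as})
          (add_diagonal (\<lambda>u. 0 + real (card {p \<in> pendant_indices as. Spine (fst p) = u}) / 3)
            (laplacian (pendant_tree as)))"
    using permanent_laplacian_peel[OF finite_pendant_indices subset_refl, of "\<lambda>u. 0" as]
    by (simp add: pverts_pendant_tree card_pendant_indices)
  also have "permanent (Spine ` {..<length as})
      (add_diagonal (\<lambda>u. 0 + real (card {p \<in> pendant_indices as. Spine (fst p) = u}) / 3)
        (laplacian (pendant_tree as)))
      = permanent (Spine ` {..<length as}) (spine_matrix as)"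
    by (rule permanent_cong) (auto simp: spine_matrix_def add_diagonal_def card)
  finally show ?thesis .
qed

section \<open>Four spine vertices\<close>

lemma spine_neighbours_4:
  "card {k. k < 4 \<and> (k = Suc i \<or> i = Suc k)} = (if i = 0 \<or> i = 3 then 1 else 2)" if "i < 4"
proof -
  from that consider "i = 0" | "i = 1" | "i = 2" | "i = 3" by linarith
  then show ?thesis
  proof cases
    case 1
    then have "{k. k < 4 \<and> (k = Suc i \<or> i = Suc k)} = {1}" by auto
    then show ?thesis using 1 by simp
  next
    case 2
    then have "{k. k < 4 \<and> (k = Suc i \<or> i = Suc k)} = {0, 2}" by auto
    then show ?thesis using 2 by simp
  next
    case 3
    then have "{k. k < 4 \<and> (k = Suc i \<or> i = Suc k)} = {1, 3}" by auto
    then show ?thesis using 3 by simp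
  next
    case 4
    then have "{k. k < 4 \<and> (k = Suc i \<or> i = Suc k)} = {2}" by auto
    then show ?thesis using 4 by simp
  qed
qed

lemma degree_Spine_4:
  assumes "i < 4"
  shows "degree (pendant_tree [t, t, t, t]) (Spine i) = (if i = 0 \<or> i = 3 then t + 1 else t + 2)"
proof -
  from assms have "[t, t, t, t] ! i = t"
    by (auto simp: less_Suc_eq numeral_eq_Suc)
  moreover have "length [t, t, t, t] = 4" by simp
  ultimately show ?thesis
    using degree_Spine[of i "[t, t, t, t]"] assms
    by (simp only: spine_neighbours_4[OF assms]) auto
qed

lemma permanent_spine_4:
  fixes t :: nat
  defines "A \<equiv> real (4 * t + 3) / 3" and "B \<equiv> real (4 * t + 6) / 3"
  shows "permanent (Spine ` {..<4}) (spine_matrix [t, t, t, t])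
    = A\<^sup>2 * B\<^sup>2 + 2 * A * B + A\<^sup>2 + 1"
proof -
  let ?N = "spine_matrix [t, t, t, t]"
  have adj: "?N (Spine i) (Spine k) = (if k = Suc i \<or> i = Suc k then -1 else 0)"
    if "i < 4" "k < 4" "i \<noteq> k" for i k
    using that by (auto simp: spine_matrix_def add_diagonal_def laplacian_def degree_matrix_def
        adjacency_matrix_def parcs_pendant_tree pendant_tree_edges_def)
  have diag: "?N (Spine i) (Spine i) = (if i = 0 \<or> i = 3 then A else B)" if "i < 4" for i
  proof -
    have "[t, t, t, t] ! i = t" using that by (auto simp: less_Suc_eq numeral_eq_Suc)
    then show ?thesis using that degree_Spine_4[OF that, of t]
      by (auto simp: spine_matrix_def add_diagonal_def laplacian_def degree_matrix_def
        adjacency_matrix_def parcs_pendant_tree pendant_tree_edges_def A_def B_def field_simps)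
  qed
  have p0: "permanent {} ?N = 1" by (simp add: permanent_def)
  have p3: "permanent {Spine 3} ?N = A"
    using permanent_isolated[of "{}" "Spine 3" ?N] by (simp add: p0 diag)
  have p23: "permanent {Spine 2, Spine 3} ?N = B * A + 1"
    by (subst permanent_leaf[where y = "Spine 3"]) (auto simp: p0 p3 adj diag)
  have p123: "permanent {Spine 1, Spine 2, Spine 3} ?N = B * (B * A + 1) + A"
    by (subst permanent_leaf[where y = "Spine 2"]) (auto simp: p3 p23 adj diag simp del: One_nat_def)
  have "permanent {Spine 0, Spine 1, Spine 2, Spine 3} ?N
      = A * (B * (B * A + 1) + A) + (B * A + 1)"
    by (subst permanent_leaf[where y = "Spine 1"]) (auto simp: p23 p123 adj diag simp del: One_nat_def)
  moreover have "Spine ` {..<4} = {Spine 0, Spine 1, Spine 2, Spine 3}"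
    by (auto simp: less_Suc_eq numeral_eq_Suc lessThan_Suc)
  ultimately show ?thesis by (simp add: power2_eq_square algebra_simps)
qed

lemma laplacian_ratio_4:
  fixes t :: nat
  defines "A \<equiv> real (4 * t + 3) / 3" and "B \<equiv> real (4 * t + 6) / 3"
  shows "laplacian_ratio (pendant_tree [t, t, t, t])
    = (3 / 2) ^ (4 * t) * ((A\<^sup>2 * B\<^sup>2 + 2 * A * B + A\<^sup>2 + 1) / ((real t + 1)\<^sup>2 * (real t + 2)\<^sup>2))"
proof -
  have "(\<Prod>i<4. real (degree (pendant_tree [t, t, t, t]) (Spine i)))
      = (\<Prod>i<(4::nat). if i = 0 \<or> i = 3 then real t + 1 else real t + 2)"
    by (rule prod.cong) (auto simp: degree_Spine_4)
  also have "\<dots> = (real t + 1)\<^sup>2 * (real t + 2)\<^sup>2"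
    by (simp add: numeral_eq_Suc lessThan_Suc)
  finally have d: "(\<Prod>i<4. real (degree (pendant_tree [t, t, t, t]) (Spine i)))
      = (real t + 1)\<^sup>2 * (real t + 2)\<^sup>2" .
  have as: "length [t, t, t, t] = 4" "sum_list [t, t, t, t] = 4 * t" by simp_all
  show ?thesis
    unfolding laplacian_ratio_def permanent_laplacian_pendant_tree prod_degree_pendant_tree as d
      permanent_spine_4 A_def[symmetric] B_def[symmetric]
    by (simp only: power_divide times_divide_times_eq)
qed

lemma spine_factor_bound:
  fixes x :: real
  assumes "x \<ge> 4"
  defines "A \<equiv> (4 * x + 3) / 3" and "B \<equiv> (4 * x + 6) / 3"
  shows "(32 * x\<^sup>2 + 40 * x + 15) / (6 * (2 * x + 1) * (x + 1))
    < (A\<^sup>2 * B\<^sup>2 + 2 * A * B + A\<^sup>2 + 1) / ((x + 1)\<^sup>2 * (x + 2)\<^sup>2)"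
proof -
  define s where "s = x - 4"
  have x: "x = s + 4" and s: "s \<ge> 0" using assms(1) by (auto simp: s_def)
  have eq: "A\<^sup>2 * B\<^sup>2 + 2 * A * B + A\<^sup>2 + 1 = ((4 * x + 3)\<^sup>2 * (4 * x + 6)\<^sup>2
      + 18 * (4 * x + 3) * (4 * x + 6) + 9 * (4 * x + 3)\<^sup>2 + 81) / 81"
    by (simp add: A_def B_def power2_eq_square field_simps)
  \<comment> \<open>Written in \<open>s\<close>, the difference of the two sides is
    \<open>160 s^5 + 2920 s^4 + 19923 s^3 + 60283 s^2 + 68680 s + 1584\<close>.\<close>
  have main: "(32 * x\<^sup>2 + 40 * x + 15) * 27 * (x + 1) * (x + 2)\<^sup>2
      < ((4 * x + 3)\<^sup>2 * (4 * x + 6)\<^sup>2 + 18 * (4 * x + 3) * (4 * x + 6)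
          + 9 * (4 * x + 3)\<^sup>2 + 81) * 2 * (2 * x + 1)"
    using s unfolding x by (simp add: power2_eq_square algebra_simps add_pos_nonneg)
  have frac: "Q / (6 * p * q) < N / 81 / (q\<^sup>2 * r\<^sup>2)"
    if "p > 0" "q > 0" "r > 0" "Q * 27 * q * r\<^sup>2 < N * 2 * p" for p q r Q N :: real
  proof -
    have "Q / (6 * p * q) = (Q * 27 * q * r\<^sup>2) / (162 * p * q\<^sup>2 * r\<^sup>2)"
      using that by (simp add: divide_simps power2_eq_square)
    also have "\<dots> < (N * 2 * p) / (162 * p * q\<^sup>2 * r\<^sup>2)"
      using that by (intro divide_strict_right_mono) auto
    also have "\<dots> = N / 81 / (q\<^sup>2 * r\<^sup>2)"
      using that by (simp add: divide_simps power2_eq_square)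
    finally show ?thesis .
  qed
  show ?thesis
    unfolding eq by (rule frac[OF _ _ _ main]) (use assms(1) in simp_all)
qed

theorem mainTheorem3:
  fixes t n :: nat
  assumes "t \<ge> 4"
    and "n = card (pverts (pendant_tree [t, t, t, t]))"
  shows "n = 8 * t + 4 \<and> 4 dvd n \<and>
    laplacian_ratio (pendant_tree [t, t, t, t]) >
      (4 * real n ^ 2 + 8 * real n + 24) / (real n * (real n + 4))
        * (3 / 2) powr ((real n - 6) / 2)"
proof -
  have n: "n = 8 * t + 4" using assms(2) by (simp add: card_pverts_pendant_tree)
  have "(real n - 6) / 2 = real (4 * t) - 1" by (simp add: n)
  then have pow: "(3 / 2) powr ((real n - 6) / 2) = (3 / 2 :: real) ^ (4 * t) * (2 / 3)"
    by (simp only: powr_diff powr_realpow) simp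
  have coeff: "(4 * real n ^ 2 + 8 * real n + 24) / (real n * (real n + 4)) * (2 / 3)
      = (32 * (real t)\<^sup>2 + 40 * real t + 15) / (6 * (2 * real t + 1) * (real t + 1))"
    by (simp add: n divide_simps) (simp add: power2_eq_square algebra_simps)
  have "(3 / 2 :: real) ^ (4 * t) * ((32 * (real t)\<^sup>2 + 40 * real t + 15)
        / (6 * (2 * real t + 1) * (real t + 1)))
      < laplacian_ratio (pendant_tree [t, t, t, t])"
    unfolding laplacian_ratio_4
    by (rule mult_strict_left_mono) (use spine_factor_bound[of "real t"] assms(1) in simp_all)
  then have "(4 * real n ^ 2 + 8 * real n + 24) / (real n * (real n + 4))
        * (3 / 2) powr ((real n - 6) / 2) < laplacian_ratio (pendant_tree [t, t, t, t])"
    unfolding pow coeff[symmetric] by (simp only: mult_ac)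
  moreover have "4 dvd n" using n by simp
  ultimately show ?thesis using n by simp
qed

end
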